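(* Let $G^c$ be a $c$-edge-coloured multigraph on $n \geq 2$ vertices with $c\geq 3$ and $m$ edges. If $m\geq c\binom{n-1}{2}+1$, then $G^c$ has a proper Hamiltonian path.
   Context: A $c$-edge-coloured multigraph $G^c$ is a multigraph in which every edge receives one colour from $\{1,\ldots,c\}$ and no two parallel edges joining the same pair of vertices have the same colour; $m$ counts all edges. A path is proper if any two consecutive edges have different colours; a proper Hamiltonian path is a proper path containing all vertices. *)

theory Defs
  imports Main
begin

text \<open>
  Edges have an identity of their own (type \<open>'e\<close>), so parallel edges are allowed.  Loops are
  not: every edge joins two distinct vertices.  The edge set is finite because the vertex set
  and the set of colours are finite and parallel edges have distinct colours.  Not every colour
  has to occur.
\<close>

locale edge_coloured_multigraph =
  fixes V :: "'v set" and E :: "'e set"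
    and ends :: "'e \<Rightarrow> 'v set" and col :: "'e \<Rightarrow> nat" and c :: nat
  assumes finite_vertices: "finite V"
    and ends_vertices: "e \<in> E \<Longrightarrow> ends e \<subseteq> V \<and> card (ends e) = 2"
    and colour_range: "e \<in> E \<Longrightarrow> col e \<in> {1..c}"
    and parallel_colours: "\<lbrakk>e \<in> E; f \<in> E; e \<noteq> f; ends e = ends f\<rbrakk> \<Longrightarrow> col e \<noteq> col f"
begin

text \<open>A path is given by its vertex sequence together with its edge sequence.\<close>

definition is_path :: "'v list \<Rightarrow> 'e list \<Rightarrow> bool" where
  "is_path vs es \<longleftrightarrow>
     length vs = length es + 1 \<and> distinct vs \<and> set vs \<subseteq> V \<and> set es \<subseteq> E \<and>
     (\<forall>i < length es. ends (es ! i) = {vs ! i, vs ! Suc i})"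

definition is_proper_path :: "'v list \<Rightarrow> 'e list \<Rightarrow> bool" where
  "is_proper_path vs es \<longleftrightarrow>
     is_path vs es \<and> (\<forall>i. Suc i < length es \<longrightarrow> col (es ! i) \<noteq> col (es ! Suc i))"

definition is_proper_hamiltonian_path :: "'v list \<Rightarrow> 'e list \<Rightarrow> bool" where
  "is_proper_hamiltonian_path vs es \<longleftrightarrow> is_proper_path vs es \<and> set vs = V"

end

end

theory Submission
  imports Defs "HOL-Library.Multiset"
begin

text \<open>
  By averaging, some three colours together contain more than \<open>3 * ((n - 1) choose 2)\<close> edges, so
  with respect to them fewer than \<open>3 * (n - 1)\<close> coloured edges are missing.  A vertex with at
  most \<open>N + 1\<close> missing edges to a proper path on \<open>N\<close> vertices can be inserted into it.  Hence,
  if some vertex has between \<open>3\<close> and \<open>n\<close> missing edges, we delete it, use induction and reinsert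
  it.  Otherwise the vertices have either at most \<open>2\<close> missing edges (and can be inserted into any
  path), or more than \<open>n\<close>; the latter are at most four by counting, and it suffices to find a
  proper path through all of them.
\<close>

section \<open>Three-coloured multigraphs, missing colours and deficits\<close>

text \<open>\<open>A u v\<close> is the set of colours of the edges between \<open>u\<close> and \<open>v\<close>.\<close>

locale three_coloured =
  fixes K :: "'c set" and A :: "'v \<Rightarrow> 'v \<Rightarrow> 'c set"
  assumes card_K: "card K = 3"
    and A_subset: "A u v \<subseteq> K"
    and A_sym: "A u v = A v u"
begin

text \<open>
  The first argument of \<open>walk\<close> is the colour of an edge preceding the path, if any, which the first
  edge has to avoid.
\<close>

fun walk :: "'c option \<Rightarrow> 'v list \<Rightarrow> 'c list \<Rightarrow> bool" where
  "walk p [v] [] = True"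
| "walk p (u # v # vs) (x # xs) \<longleftrightarrow> x \<in> A u v \<and> p \<noteq> Some x \<and> walk (Some x) (v # vs) xs"
| "walk _ _ _ = False"

definition miss :: "'v \<Rightarrow> 'v \<Rightarrow> nat" where
  "miss u v = 3 - card (A u v)"

text \<open>The vertex set is an argument because the induction deletes vertices while
  \<open>A\<close> stays fixed.\<close>

definition deficit :: "'v set \<Rightarrow> 'v \<Rightarrow> nat" where
  "deficit V v = (\<Sum>u\<in>V - {v}. miss v u)"

text \<open>A \<open>walk\<close> has at least one vertex, so the empty set is not
  traceable.\<close>

definition traceable :: "'v set \<Rightarrow> bool" where
  "traceable W \<longleftrightarrow> (\<exists>vs xs. walk None vs xs \<and> distinct vs \<and> set vs = W)"

lemma finite_K [simp]: "finite K"
  using card_K by (metis card.infinite zero_neq_numeral)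

lemma finite_A [simp]: "finite (A u v)"
  using A_subset finite_K finite_subset by blast

lemma card_A_le: "card (A u v) \<le> 3"
  using card_mono[OF finite_K A_subset] card_K by metis

lemma miss_sym: "miss u v = miss v u"
  by (simp add: miss_def A_sym)

lemma miss_le: "miss u v \<le> 3"
  by (simp add: miss_def)

lemma miss_card_A: "miss u v + card (A u v) = 3"
  using card_A_le[of u v] by (simp add: miss_def)

lemma miss_0_A: "miss u v = 0 \<Longrightarrow> A u v = K"
  using miss_card_A[of u v] card_K A_subset card_subset_eq[OF finite_K] by simp

lemma A_nonempty: "miss u v \<le> 2 \<Longrightarrow> \<exists>x. x \<in> A u v"
  using miss_card_A[of u v] by (cases "A u v = {}") auto

lemma A_avoid:
  assumes "miss u v + card X \<le> 2" "finite X"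
  shows "\<exists>x \<in> A u v. x \<notin> X"
proof (rule ccontr)
  assume "\<not> ?thesis"
  hence "card (A u v) \<le> card X" using assms(2) by (intro card_mono) auto
  thus False using miss_card_A[of u v] assms(1) by simp
qed

lemma K_avoid: "\<exists>z \<in> K. z \<noteq> x \<and> z \<noteq> y"
proof (rule ccontr)
  assume "\<not> ?thesis"
  hence "card K \<le> card {x, y}" by (intro card_mono) auto
  also have "\<dots> \<le> 2" by (simp add: card_insert_le_m1)
  finally show False using card_K by simp
qed

lemma miss_ge_2: "A u v \<subseteq> {x} \<Longrightarrow> miss u v \<ge> 2"
  using card_mono[of "{x}" "A u v"] by (simp add: miss_def)

section \<open>Inserting a vertex into a proper path\<close>

text \<open>
  The right-hand side is larger by one if \<open>v\<close> cannot be put in front of \<open>u\<close>.  This makes the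
  induction work: a gap between \<open>u\<close> and \<open>w\<close> is blocked only if one of the two sides offers no
  colour, or both sides offer the same single colour.
\<close>

lemma no_insertion_miss:
  assumes "walk p (u # vs) xs"
    and "\<nexists>vs' xs'. mset vs' = add_mset v (mset vs) \<and> walk p (u # vs') xs'"
  shows "(\<Sum>w\<leftarrow>u # vs. miss v w) \<ge>
    length (u # vs) + (if \<exists>\<beta>\<in>A v u. walk (Some \<beta>) (u # vs) xs then 1 else 2)"
  using assms
proof (induction vs arbitrary: p u xs)
  case Nil
  hence [simp]: "xs = []" by (cases xs) auto
  \<comment> \<open>Putting \<open>v\<close> behind the only vertex \<open>u\<close> can fail only
    because of \<open>p\<close>.\<close>
  have *: "p = Some x" if "x \<in> A v u" for x
  proof (rule ccontr)
    assume "p \<noteq> Some x"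
    hence "walk p (u # [v]) [x]" using that A_sym by auto
    thus False using Nil(2) by (metis mset.simps(1) mset.simps(2))
  qed
  show ?case
  proof (cases "A v u = {}")
    case True thus ?thesis by (simp add: miss_def)
  next
    case False
    then obtain x where "x \<in> A v u" by auto
    hence "A v u \<subseteq> {x}" by (auto dest!: *)
    from miss_ge_2[OF this] show ?thesis using \<open>x \<in> A v u\<close> by auto
  qed
next
  case (Cons w vs)
  from Cons.prems(1) obtain x ys where xs: "xs = x # ys" and x: "x \<in> A u w" "p \<noteq> Some x"
    and wk: "walk (Some x) (w # vs) ys" by (cases xs) auto
  have IH: "(\<Sum>z\<leftarrow>w # vs. miss v z) \<ge>
    length (w # vs) + (if \<exists>\<beta>\<in>A v w. walk (Some \<beta>) (w # vs) ys then 1 else 2)"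
  proof (rule Cons.IH[OF wk])
    show "\<nexists>vs' xs'. mset vs' = add_mset v (mset vs) \<and> walk (Some x) (w # vs') xs'"
    proof
      assume "\<exists>vs' xs'. mset vs' = add_mset v (mset vs) \<and> walk (Some x) (w # vs') xs'"
      then obtain vs' xs' where "mset vs' = add_mset v (mset vs)" "walk (Some x) (w # vs') xs'"
        by blast
      hence "mset (w # vs') = add_mset v (mset (w # vs))" "walk p (u # w # vs') (x # xs')"
        using x by auto
      thus False using Cons.prems(2) by blast
    qed
  qed
  \<comment> \<open>Two different colours would allow \<open>v\<close> between \<open>u\<close> and
    \<open>w\<close>.\<close>
  have gap: "\<alpha> = \<beta>" if "\<alpha> \<in> A v u" "p \<noteq> Some \<alpha>" "\<beta> \<in> A v w" "walk (Some \<beta>) (w # vs) ys" for \<alpha> \<beta>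
  proof (rule ccontr)
    assume "\<alpha> \<noteq> \<beta>"
    hence "walk p (u # v # w # vs) (\<alpha> # \<beta> # ys)" using that A_sym by auto
    moreover have "mset (v # w # vs) = add_mset v (mset (w # vs))" by simp
    ultimately show False using Cons.prems(2) by blast
  qed
  define R where "R \<longleftrightarrow> (\<exists>\<beta>\<in>A v w. walk (Some \<beta>) (w # vs) ys)"
  define S where "S \<longleftrightarrow> (\<exists>\<beta>\<in>A v u. walk (Some \<beta>) (u # w # vs) xs)"
  \<comment> \<open>Any colour other than \<open>x\<close> could lead from \<open>v\<close> into the
    whole path.\<close>
  have S2: "miss v u \<ge> 2" if "\<not> S"
  proof (rule miss_ge_2)
    show "A v u \<subseteq> {x}" using that x wk unfolding S_def xs by auto
  qed
  \<comment> \<open>By \<open>gap\<close> only \<beta> and the colour in \<open>p\<close> can occur,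
    so one of the three is missing.\<close>
  have R1: "miss v u \<ge> 1" if R
  proof -
    from that obtain \<beta> where b: "\<beta> \<in> A v w" "walk (Some \<beta>) (w # vs) ys" unfolding R_def by blast
    have "A v u \<subseteq> {\<beta>} \<union> set_option p" using gap[OF _ _ b] by (cases p) auto
    hence "card (A v u) \<le> card ({\<beta>} \<union> set_option p)" by (intro card_mono) auto
    also have "\<dots> \<le> 2" by (cases p) (auto simp: card_insert_le_m1)
    finally show ?thesis using miss_card_A[of v u] by simp
  qed
  \<comment> \<open>Needed from \<open>miss v u\<close>: 1 if \<open>R\<close> and \<open>S\<close>
    hold, 2 if only \<open>R\<close>, 1 if neither, nothing if only \<open>S\<close>.\<close>
  show ?case using IH S2 R1 unfolding R_def[symmetric] S_def[symmetric]
    by (cases R; cases S) auto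
qed

text \<open>If no place behind \<open>u\<close> works, the bound on the sum rules out the summand 2
  in \<open>no_insertion_miss\<close>, so \<open>v\<close> fits in front of
  \<open>u\<close>.\<close>

lemma walk_insert:
  assumes "walk None (u # vs) xs" "(\<Sum>w\<leftarrow>u # vs. miss v w) \<le> length (u # vs) + 1"
  shows "\<exists>vs' xs'. mset vs' = add_mset v (mset (u # vs)) \<and> walk None vs' xs'"
proof (rule ccontr)
  assume no: "\<not> ?thesis"
  have "\<nexists>vs' xs'. mset vs' = add_mset v (mset vs) \<and> walk None (u # vs') xs'"
  proof
    assume "\<exists>vs' xs'. mset vs' = add_mset v (mset vs) \<and> walk None (u # vs') xs'"
    then obtain vs' xs' where "mset vs' = add_mset v (mset vs)" "walk None (u # vs') xs'" by blast
    hence "mset (u # vs') = add_mset v (mset (u # vs))" by simp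
    thus False using no \<open>walk None (u # vs') xs'\<close> by blast
  qed
  from no_insertion_miss[OF assms(1) this]
  obtain \<beta> where "\<beta> \<in> A v u" "walk (Some \<beta>) (u # vs) xs"
    using assms(2) by (auto split: if_splits)
  hence "walk None (v # u # vs) (\<beta> # xs)" by simp
  moreover have "mset (v # u # vs) = add_mset v (mset (u # vs))" by simp
  ultimately show False using no by blast
qed

lemma traceable_insert:
  assumes "traceable W" "v \<notin> W" "(\<Sum>w\<in>W. miss v w) \<le> card W + 1"
  shows "traceable (insert v W)"
proof -
  from assms(1) obtain vs xs where w: "walk None vs xs" "distinct vs" "set vs = W"
    unfolding traceable_def by blast
  then obtain u us where vs: "vs = u # us" by (cases vs) auto
  have "(\<Sum>w\<leftarrow>u # us. miss v w) \<le> length (u # us) + 1"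
    using assms(3) w(2,3) unfolding vs[symmetric]
    by (auto simp: sum_list_distinct_conv_sum_set distinct_card)
  from walk_insert[OF w(1)[unfolded vs] this] obtain vs' xs'
    where m: "mset vs' = add_mset v (mset vs)" and wk: "walk None vs' xs'" unfolding vs by blast
  have m': "mset vs' = mset (v # vs)" using m by simp
  have "distinct (v # vs)" using w assms(2) by simp
  hence "distinct vs'" using m' mset_eq_imp_distinct_iff by blast
  moreover have "set vs' = insert v W" using mset_eq_setD[OF m'] w(3) by simp
  ultimately show ?thesis unfolding traceable_def using wk by blast
qed

lemma miss_le_deficit: "finite V \<Longrightarrow> W \<subseteq> V - {v} \<Longrightarrow> (\<Sum>w\<in>W. miss v w) \<le> deficit V v"
  unfolding deficit_def by (intro sum_mono2) auto

text \<open>The remaining vertices are inserted one by one: \<open>W\<close> is nonempty, so a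
  deficit of 2 is at most \<open>card W + 1\<close>.\<close>

lemma traceable_extend:
  assumes "finite V" "traceable W" "W \<subseteq> V" "\<And>v. v \<in> V - W \<Longrightarrow> deficit V v \<le> 2"
  shows "traceable V"
  using assms(2-)
proof (induction "card (V - W)" arbitrary: W)
  case 0
  hence "V = W" using assms(1) by auto
  thus ?case using 0 by simp
next
  case (Suc k)
  then obtain v where v: "v \<in> V - W" by (metis card.empty ex_in_conv nat.distinct(1))
  have "W \<noteq> {}" using Suc.prems(1) unfolding traceable_def by auto
  hence "card W \<ge> 1" using Suc.prems(2) assms(1)
    by (metis One_nat_def Suc_leI card_gt_0_iff finite_subset)
  moreover have "(\<Sum>w\<in>W. miss v w) \<le> deficit V v"
    using v Suc.prems(2) by (intro miss_le_deficit assms) auto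
  ultimately have "traceable (insert v W)"
    using Suc.prems(3)[OF v] v Suc.prems(1) by (intro traceable_insert) auto
  moreover have "k = card (V - insert v W)"
    using Suc.hyps(2) card_Diff_singleton[OF v] by (simp flip: Diff_insert)
  ultimately show ?case using Suc.prems v by (intro Suc.hyps(1)[of "insert v W"]) auto
qed

section \<open>Deficits after deleting a vertex\<close>

lemma deficit_delete:
  assumes "finite V" "v \<in> V" "u \<in> V" "u \<noteq> v"
  shows "deficit V u = deficit (V - {v}) u + miss v u"
proof -
  have "V - {u} = insert v (V - {v} - {u})" using assms by auto
  thus ?thesis unfolding deficit_def using assms by (simp add: miss_sym)
qed

text \<open>Each edge missing at \<open>v\<close> is counted at both of its ends.\<close>

lemma total_delete:
  assumes "finite V" "v \<in> V"
  shows "sum (deficit V) V = sum (deficit (V - {v})) (V - {v}) + 2 * deficit V v"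
proof -
  have "sum (deficit V) V = deficit V v + sum (deficit V) (V - {v})"
    using assms by (simp add: sum.remove)
  also have "sum (deficit V) (V - {v}) = (\<Sum>u\<in>V - {v}. deficit (V - {v}) u + miss v u)"
    using assms by (intro sum.cong) (auto simp: deficit_delete)
  also have "\<dots> = sum (deficit (V - {v})) (V - {v}) + deficit V v"
    by (simp add: sum.distrib deficit_def)
  finally show ?thesis by simp
qed

section \<open>Short proper paths through prescribed vertices\<close>

text \<open>One side misses at most one colour, so it still offers a choice after the colour on the
  other side is fixed.\<close>

lemma colours_through:
  assumes "miss t a + miss t b \<le> 2"
  shows "\<exists>x y. x \<in> A a t \<and> y \<in> A t b \<and> x \<noteq> y"
proof (cases "miss t b \<le> 1")
  case True
  obtain x where "x \<in> A t a" using A_nonempty[of t a] assms by auto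
  moreover obtain y where "y \<in> A t b" "y \<notin> {x}" using A_avoid[of t b "{x}"] True by auto
  ultimately show ?thesis using A_sym by blast
next
  case False
  obtain y where "y \<in> A t b" using A_nonempty[of t b] assms by auto
  moreover obtain x where "x \<in> A t a" "x \<notin> {y}" using A_avoid[of t a "{y}"] assms False by auto
  ultimately show ?thesis using A_sym by blast
qed

text \<open>Every vertex not fully joined to \<open>t\<close> contributes at least 1 to the
  sum.\<close>

lemma full_neighbours:
  assumes "finite B" "(\<Sum>b\<in>B. miss t b) \<le> 2"
  shows "card B \<le> card {b \<in> B. miss t b = 0} + 2"
proof -
  have "card {b \<in> B. miss t b \<noteq> 0} = (\<Sum>b\<in>{b \<in> B. miss t b \<noteq> 0}. 1)" by simp
  also have "\<dots> \<le> (\<Sum>b\<in>{b \<in> B. miss t b \<noteq> 0}. miss t b)" by (intro sum_mono) auto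
  also have "\<dots> \<le> (\<Sum>b\<in>B. miss t b)" using assms(1) by (intro sum_mono2) auto
  finally have "card {b \<in> B. miss t b \<noteq> 0} \<le> 2" using assms(2) by simp
  moreover have "card B = card {b \<in> B. miss t b = 0} + card {b \<in> B. miss t b \<noteq> 0}"
    using assms(1) by (subst card_Un_disjoint[symmetric]) (auto intro!: arg_cong[where f = card])
  ultimately show ?thesis by simp
qed

lemma traceable_through_2:
  assumes "distinct [a, t, b]" "miss t a + miss t b \<le> 2"
  shows "traceable {a, t, b}"
proof -
  obtain x y where "x \<in> A a t" "y \<in> A t b" "x \<noteq> y" using colours_through[OF assms(2)] by blast
  hence "walk None [a, t, b] [x, y]" by simp
  moreover have "set [a, t, b] = {a, t, b}" by simp
  ultimately show ?thesis unfolding traceable_def using assms(1) by metis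
qed

text \<open>The path is \<open>a t b u c\<close> with \<open>t\<close> fully joined to
  \<open>b\<close>: the colour of that edge is chosen last, avoiding both neighbouring ones.\<close>

lemma traceable_through_3:
  assumes "card B = 3" "t \<noteq> u" "t \<notin> B" "u \<notin> B"
    "(\<Sum>b\<in>B. miss t b) \<le> 2" "(\<Sum>b\<in>B. miss u b) \<le> 2"
  shows "traceable (insert t (insert u B))"
proof -
  have fB: "finite B" using assms(1) by (metis card.infinite zero_neq_numeral)
  obtain b where b: "b \<in> B" "miss t b = 0"
    using full_neighbours[OF fB assms(5)] assms(1) by (cases "{b \<in> B. miss t b = 0} = {}") auto
  have "card (B - {b}) = 2" using b assms(1) by simp
  then obtain a c where ac: "B - {b} = {a, c}" "a \<noteq> c" by (meson card_2_iff)
  hence B: "B = {a, b, c}" "distinct [a, b, c]" using b by auto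
  have u: "miss u b + miss u c \<le> 2" "miss t a \<le> 2" using assms(5,6) B by auto
  obtain z w where zw: "z \<in> A b u" "w \<in> A u c" "z \<noteq> w" using colours_through[OF u(1)] by blast
  obtain x where x: "x \<in> A t a" using A_nonempty u by blast
  obtain y where "y \<in> K" "y \<noteq> x" "y \<noteq> z" using K_avoid by blast
  hence "walk None [a, t, b, u, c] [x, y, z, w]" using zw x miss_0_A[OF b(2)] A_sym by auto
  moreover have "set [a, t, b, u, c] = insert t (insert u B)" using B by auto
  moreover have "distinct [a, t, b, u, c]" using B assms by auto
  ultimately show ?thesis unfolding traceable_def by metis
qed

text \<open>The path is \<open>a t b u c r d\<close>. The edges \<open>t b\<close> and
  \<open>c r\<close> carry all three colours and are coloured last.\<close>

lemma traceable_through_4: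
  assumes "card B = 4" "distinct [t, u, r]" "t \<notin> B" "u \<notin> B" "r \<notin> B"
    "(\<Sum>b\<in>B. miss t b) \<le> 2" "(\<Sum>b\<in>B. miss u b) \<le> 2" "(\<Sum>b\<in>B. miss r b) \<le> 2"
  shows "traceable (insert t (insert u (insert r B)))"
proof -
  have fB: "finite B" using assms(1) by (metis card.infinite zero_neq_numeral)
  obtain b where b: "b \<in> B" "miss t b = 0"
    using full_neighbours[OF fB assms(6)] assms(1) by (cases "{b \<in> B. miss t b = 0} = {}") auto
  \<comment> \<open>At least two of the four vertices are fully joined to \<open>r\<close>, so one
    of them is not \<open>b\<close>.\<close>
  have "\<not> {c \<in> B. miss r c = 0} \<subseteq> {b}"
    using full_neighbours[OF fB assms(8)] assms(1) card_mono[of "{b}" "{c \<in> B. miss r c = 0}"] by auto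
  then obtain c where c: "c \<in> B" "miss r c = 0" "c \<noteq> b" by blast
  have "card (B - {b} - {c}) = 2" using b c assms(1) by (simp add: card_Diff_singleton_if)
  then obtain a d where ad: "B - {b} - {c} = {a, d}" "a \<noteq> d" by (meson card_2_iff)
  hence B: "B = {a, b, c, d}" "distinct [a, b, c, d]" using b c by auto
  have u: "miss u b + miss u c \<le> 2" "miss t a \<le> 2" "miss r d \<le> 2" using assms(6-8) B by auto
  obtain z w where zw: "z \<in> A b u" "w \<in> A u c" "z \<noteq> w" using colours_through[OF u(1)] by blast
  obtain x where x: "x \<in> A t a" using A_nonempty u by blast
  obtain y where y: "y \<in> K" "y \<noteq> x" "y \<noteq> z" using K_avoid by blast
  obtain x' where x': "x' \<in> A r d" using A_nonempty u by blast
  obtain y' where y': "y' \<in> K" "y' \<noteq> x'" "y' \<noteq> w" using K_avoid by blast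
  have "walk None [a, t, b, u, c, r, d] [x, y, z, w, y', x']"
    using zw x y x' y' miss_0_A[OF b(2)] miss_0_A[OF c(2)] A_sym by auto
  moreover have "set [a, t, b, u, c, r, d] = insert t (insert u (insert r B))" using B by auto
  moreover have "distinct [a, t, b, u, c, r, d]" using B assms by auto
  ultimately show ?thesis unfolding traceable_def by metis
qed

text \<open>Without an edge every ordered pair of distinct vertices would contribute 3 to the
  total.\<close>

lemma exists_edge_inside:
  assumes "finite B" "sum (deficit B) B < 3 * card B * (card B - 1)"
  shows "\<exists>a b x. a \<in> B \<and> b \<in> B \<and> a \<noteq> b \<and> x \<in> A a b"
proof (rule ccontr)
  assume "\<not> ?thesis"
  hence *: "miss a b = 3" if "a \<in> B" "b \<in> B" "a \<noteq> b" for a b using that A_nonempty[of a b] miss_le[of a b]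
    by (metis le_antisym not_less_eq_eq numeral_2_eq_2 numeral_3_eq_3)
  have "deficit B a = 3 * (card B - 1)" if "a \<in> B" for a
  proof -
    have "deficit B a = (\<Sum>b\<in>B - {a}. 3)" unfolding deficit_def using that * by (intro sum.cong) auto
    thus ?thesis using that assms(1) by simp
  qed
  hence "sum (deficit B) B = (\<Sum>a\<in>B. 3 * (card B - 1))" by (intro sum.cong) auto
  thus False using assms(2) by simp
qed

text \<open>With \<open>t\<close> as the only separator, the edge \<open>a b\<close> comes first. It
  is entered at the end from which \<open>t\<close> can be left: at most one of \<open>a\<close>,
  \<open>b\<close> misses two colours to \<open>t\<close>.\<close>

lemma traceable_edge_3:
  assumes "distinct [a, b, c, t]" "p \<in> A a b" "miss t a + miss t b + miss t c \<le> 2"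
  shows "traceable {a, b, c, t}"
proof -
  \<comment> \<open>Stated for any \<open>b\<close>, so that it serves both ends of the edge
    coloured \<open>p\<close>.\<close>
  have *: "\<exists>q r. q \<in> A b t \<and> r \<in> A t c \<and> q \<noteq> p \<and> q \<noteq> r"
    if m: "miss t b + miss t c \<le> 2" "miss t b \<le> 1" for b
  proof (cases "miss t b = 0")
    case True
    obtain r where "r \<in> A t c" using A_nonempty[of t c] m by auto
    moreover obtain q where "q \<in> K" "q \<noteq> p" "q \<noteq> r" using K_avoid by blast
    ultimately show ?thesis using miss_0_A[OF True] A_sym by blast
  next
    case False
    obtain q where "q \<in> A t b" "q \<notin> {p}" using A_avoid[of t b "{p}"] m by auto
    moreover obtain r where "r \<in> A t c" "r \<notin> {q}" using A_avoid[of t c "{q}"] m False by auto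
    ultimately show ?thesis using A_sym by blast
  qed
  show ?thesis
  proof (cases "miss t b \<le> 1")
    case True
    then obtain q r where "q \<in> A b t" "r \<in> A t c" "q \<noteq> p" "q \<noteq> r" using *[of b] assms(3) by auto
    hence "walk None [a, b, t, c] [p, q, r]" using assms(2) by simp
    moreover have "set [a, b, t, c] = {a, b, c, t}" "distinct [a, b, t, c]" using assms(1) by auto
    ultimately show ?thesis unfolding traceable_def by metis
  next
    case False
    then obtain q r where "q \<in> A a t" "r \<in> A t c" "q \<noteq> p" "q \<noteq> r" using *[of a] assms(3) by auto
    hence "walk None [b, a, t, c] [p, q, r]" using assms(2) A_sym by auto
    moreover have "set [b, a, t, c] = {a, b, c, t}" "distinct [b, a, t, c]" using assms(1) by auto
    ultimately show ?thesis unfolding traceable_def by metis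
  qed
qed

text \<open>The path is \<open>a b t c u d\<close>. The colours around \<open>u\<close> are fixed
  first, and both edges at \<open>t\<close> have a free choice.\<close>

lemma traceable_edge_4:
  assumes "distinct [a, b, c, d, t, u]" "p \<in> A a b" "miss t b = 0" "miss t c = 0"
    "miss u c + miss u d \<le> 2"
  shows "traceable {a, b, c, d, t, u}"
proof -
  obtain z w where zw: "z \<in> A c u" "w \<in> A u d" "z \<noteq> w" using colours_through[OF assms(5)] by blast
  obtain q where q: "q \<in> K" "q \<noteq> p" using K_avoid by blast
  obtain r where r: "r \<in> K" "r \<noteq> q" "r \<noteq> z" using K_avoid by blast
  have "walk None [a, b, t, c, u, d] [p, q, r, z, w]"
    using zw q r assms(2) miss_0_A[OF assms(3)] miss_0_A[OF assms(4)] A_sym by auto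
  moreover have "set [a, b, t, c, u, d] = {a, b, c, d, t, u}" "distinct [a, b, t, c, u, d]"
    using assms(1) by auto
  ultimately show ?thesis unfolding traceable_def by metis
qed

section \<open>Total deficit and the main induction\<close>

text \<open>An edge missing between \<open>B\<close> and \<open>V - B\<close> also counts at its end
  outside \<open>B\<close>.\<close>

lemma deficit_split:
  assumes "finite V" "B \<subseteq> V"
  shows "sum (deficit V) B \<le> sum (deficit B) B + sum (deficit V) (V - B)"
proof -
  have "deficit V b = deficit B b + (\<Sum>s\<in>V - B. miss b s)" if "b \<in> B" for b
  proof -
    have "V - {b} = (B - {b}) \<union> (V - B)" using that assms by auto
    moreover have "finite (B - {b})" "finite (V - B)" "(B - {b}) \<inter> (V - B) = {}"
      using assms finite_subset by auto
    ultimately show ?thesis unfolding deficit_def by (simp add: sum.union_disjoint)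
  qed
  hence "sum (deficit V) B = sum (deficit B) B + (\<Sum>b\<in>B. \<Sum>s\<in>V - B. miss b s)"
    by (simp add: sum.distrib)
  also have "(\<Sum>b\<in>B. \<Sum>s\<in>V - B. miss b s) = (\<Sum>s\<in>V - B. \<Sum>b\<in>B. miss s b)"
    by (subst sum.swap) (simp add: miss_sym)
  also have "\<dots> \<le> sum (deficit V) (V - B)"
    using assms by (intro sum_mono miss_le_deficit) auto
  finally show ?thesis by simp
qed

lemma deficit_le: "finite B \<Longrightarrow> b \<in> B \<Longrightarrow> deficit B b \<le> 3 * (card B - 1)"
  unfolding deficit_def
  using sum_bounded_above[of "B - {b}" "miss b" 3] miss_le by simp

text \<open>
  Missing edges are counted twice in the total deficit.  Below, \<open>B\<close> is the set of vertices of
  deficit more than \<open>n\<close>.  If the other vertices are too few to separate those of \<open>B\<close> on a path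
  (\<open>n = 4\<close> for three vertices, \<open>n = 6\<close> for four), the bound on the total leaves an edge inside \<open>B\<close>.
\<close>

theorem traceable_if_total_deficit:
  assumes "finite V" "sum (deficit V) V < 6 * (card V - 1)"
  shows "traceable V"
  using assms
proof (induction "card V" arbitrary: V rule: less_induct)
  case less
  note fin = less.prems(1)
  define n where "n = card V"
  have n2: "n \<ge> 2" and tot: "sum (deficit V) V + 7 \<le> 6 * n" using less.prems(2) unfolding n_def by auto
  show ?case
  proof (cases "\<exists>v\<in>V. 3 \<le> deficit V v \<and> deficit V v \<le> n")
    case True
    then obtain v where v: "v \<in> V" "3 \<le> deficit V v" "deficit V v \<le> n" by blast
    have card: "card (V - {v}) = n - 1" using v fin n_def by simp
    \<comment> \<open>Deleting \<open>v\<close> lowers the total by at least 2 * 3, which is the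
      drop of the bound.\<close>
    have "sum (deficit (V - {v})) (V - {v}) < 6 * (card (V - {v}) - 1)"
      unfolding card using total_delete[OF fin v(1)] v(2) tot by linarith
    hence "traceable (V - {v})" using less.hyps[of "V - {v}"] card n2 fin n_def by auto
    hence "traceable (insert v (V - {v}))"
      using v(3) n2 card by (intro traceable_insert) (auto simp: deficit_def)
    thus ?thesis using v(1) by (simp add: insert_absorb)
  next
    case False
    define B where "B = {v \<in> V. deficit V v > n}"
    have BV: "B \<subseteq> V" and finB: "finite B" using fin by (auto simp: B_def)
    have small: "deficit V s \<le> 2" if "s \<in> V - B" for s
      using that False by (force simp: B_def not_le)
    have ext: "traceable V" if "traceable W" "B \<subseteq> W" "W \<subseteq> V" for W
      using that small by (intro traceable_extend[OF fin]) auto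
    have small_sum: "(\<Sum>b\<in>B. miss s b) \<le> 2" if "s \<in> V - B" for s
    proof -
      have "B \<subseteq> V - {s}" using that BV by blast
      from miss_le_deficit[OF fin this] small[OF that] show ?thesis by linarith
    qed
    have cardS: "card (V - B) = n - card B" 
      using card_Diff_subset[OF finB BV] by (auto simp: n_def)
    have low: "card B * (n + 1) \<le> sum (deficit V) B"
      using sum_bounded_below[of B "n + 1" "deficit V"] by (auto simp: B_def)
    have tot_split: "sum (deficit V) V = sum (deficit V) B + sum (deficit V) (V - B)"
      using sum.subset_diff[OF BV fin, of "deficit V"] by simp
    note split = deficit_split[OF fin BV]
    have inside_le: "sum (deficit B) B \<le> card B * (3 * (card B - 1))"
      using sum_bounded_above[of B "deficit B"] deficit_le[OF finB] by simp
    have inside_le': "sum (deficit B) B \<le> sum (deficit V) B"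
      using BV fin unfolding deficit_def by (intro sum_mono sum_mono2) auto
    have "card B * (n + 1) \<le> 6 * n" using low tot tot_split by linarith
    also have "\<dots> < 6 * (n + 1)" by simp
    finally have "card B < 6" by (simp only: mult_less_cancel2)
    \<comment> \<open>The total leaves at most \<open>n - 12\<close> outside \<open>B\<close>, so
      \<open>n\<close> is at least 12. But \<open>5 * (n + 1)\<close> is at most
      \<open>60 + (n - 12)\<close>, which forces \<open>n\<close> to be at most 10.\<close>
    moreover have "card B \<noteq> 5" using low tot tot_split split inside_le by auto
    ultimately consider "card B = 0" | "card B = 1" | "card B = 2" | "card B = 3" | "card B = 4" by linarith
    thus ?thesis
    proof cases
      case 1
      hence "B = {}" using finB by simp
      have "V \<noteq> {}" using n2 n_def by auto
      then obtain v where "v \<in> V" by blast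
      moreover have "traceable {v}" unfolding traceable_def
        by (intro exI[of _ "[v]"] exI[of _ "[]"]) simp
      ultimately show ?thesis using ext[of "{v}"] \<open>B = {}\<close> by simp
    next
      case 2
      then obtain b where b: "B = {b}" by (meson card_1_singletonE)
      have "traceable {b}" unfolding traceable_def
        by (intro exI[of _ "[b]"] exI[of _ "[]"]) simp
      thus ?thesis using ext[of "{b}"] b BV by simp
    next
      case 3
      then obtain a b where ab: "B = {a, b}" "a \<noteq> b" by (meson card_2_iff)
      \<comment> \<open>For \<open>n = 2\<close> the total would be at least 6, but it is at most
        5.\<close>
      have "card (V - B) \<noteq> 0" using 3 low tot tot_split cardS by auto
      then obtain t where t: "t \<in> V - B" by (metis card.empty ex_in_conv)
      have "traceable {a, t, b}" using small_sum[OF t] ab t by (intro traceable_through_2) auto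
      thus ?thesis using ext[of "{a, t, b}"] ab BV t by auto
    next
      case 4
      have n4: "n \<ge> 4" using 4 low tot tot_split by auto
      show ?thesis
      proof (cases "n = 4")
        case True
        have "card (V - B) = 1" using cardS 4 True by simp
        then obtain t where t: "V - B = {t}" by (meson card_1_singletonE)
        \<comment> \<open>The total is at most 17, below 3 * 3 * 2.\<close>
        have "sum (deficit B) B < 3 * card B * (card B - 1)"
          using inside_le' tot tot_split True 4 by auto
        then obtain a b x where ab: "a \<in> B" "b \<in> B" "a \<noteq> b" "x \<in> A a b"
          using exists_edge_inside[OF finB] by blast
        have "card (B - {a} - {b}) = 1" using 4 ab by (simp add: card_Diff_singleton_if)
        then obtain c where c: "B - {a} - {b} = {c}" by (meson card_1_singletonE)
        hence B: "B = {a, b, c}" "distinct [a, b, c, t]" using ab t by auto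
        have "t \<in> V - B" using t by simp
        from small_sum[OF this] have "miss t a + miss t b + miss t c \<le> 2" using B by simp
        hence "traceable {a, b, c, t}" by (rule traceable_edge_3[OF B(2) ab(4)])
        moreover have "B \<subseteq> {a, b, c, t}" "{a, b, c, t} \<subseteq> V" using B t BV by auto
        ultimately show ?thesis by (rule ext)
      next
        case False
        hence "2 \<le> card (V - B)" using n4 4 cardS by simp
        then obtain T where T: "T \<subseteq> V - B" "card T = 2" by (meson obtain_subset_with_card_n)
        then obtain t u where tu: "T = {t, u}" "t \<noteq> u" by (meson card_2_iff)
        have "traceable (insert t (insert u B))"
          using T tu 4 small_sum by (intro traceable_through_3) auto
        moreover have "B \<subseteq> insert t (insert u B)" "insert t (insert u B) \<subseteq> V"
          using T tu BV by auto
        ultimately show ?thesis by (rule ext)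
      qed
    next
      case 5
      have n6: "n \<ge> 6" using 5 low tot tot_split by auto
      show ?thesis
      proof (cases "n = 6")
        case True
        \<comment> \<open>The total is at most 29, and \<open>B\<close> accounts for at least 4 * 7
          of it.\<close>
        have le1: "sum (deficit V) (V - B) \<le> 1" using low tot tot_split True 5 by auto
        have "card (V - B) = 2" using cardS 5 True by simp
        then obtain t' u' where tu': "V - B = {t', u'}" "t' \<noteq> u'" by (meson card_2_iff)
        have "\<exists>t u. V - B = {t, u} \<and> t \<noteq> u \<and> deficit V t = 0"
        proof (cases "deficit V t' = 0")
          case True thus ?thesis using tu' by blast
        next
          case False
          hence "deficit V u' = 0" using le1 tu' by simp
          thus ?thesis using tu' by blast
        qed
        then obtain t u where tu: "V - B = {t, u}" "t \<noteq> u" "deficit V t = 0" by blast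
        have t0: "miss t b = 0" if "b \<in> B" for b
        proof -
          have "b \<in> V - {t}" using that tu BV by auto
          thus ?thesis using tu(3) fin unfolding deficit_def by auto
        qed
        \<comment> \<open>Here 29 is below 3 * 4 * 3.\<close>
        have "sum (deficit B) B < 3 * card B * (card B - 1)"
          using inside_le' tot tot_split True 5 by auto
        then obtain a b x where ab: "a \<in> B" "b \<in> B" "a \<noteq> b" "x \<in> A a b"
          using exists_edge_inside[OF finB] by blast
        have "card (B - {a} - {b}) = 2" using 5 ab by (simp add: card_Diff_singleton_if)
        then obtain c d where c: "B - {a} - {b} = {c, d}" "c \<noteq> d" by (meson card_2_iff)
        hence B: "B = {a, b, c, d}" "distinct [a, b, c, d, t, u]" using ab tu by auto
        have "traceable {a, b, c, d, t, u}"
        proof (rule traceable_edge_4[OF B(2) ab(4)])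
          have "u \<in> V - B" using tu by simp
          from small_sum[OF this] show "miss u c + miss u d \<le> 2" using B by simp
        qed (use t0 B in auto)
        moreover have "B \<subseteq> {a, b, c, d, t, u}" "{a, b, c, d, t, u} \<subseteq> V" using B tu BV by auto
        ultimately show ?thesis by (rule ext)
      next
        case False
        hence "3 \<le> card (V - B)" using n6 5 cardS by simp
        then obtain T where T: "T \<subseteq> V - B" "card T = 3" by (meson obtain_subset_with_card_n)
        then obtain t u r where tu: "T = {t, u, r}" "t \<noteq> u" "u \<noteq> r" "t \<noteq> r" by (meson card_3_iff)
        have "traceable (insert t (insert u (insert r B)))"
          using T tu 5 small_sum by (intro traceable_through_4) auto
        moreover have "B \<subseteq> insert t (insert u (insert r B))" "insert t (insert u (insert r B)) \<subseteq> V"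
          using T tu BV by auto
        ultimately show ?thesis by (rule ext)
      qed
    qed
  qed
qed

lemma walk_nth:
  assumes "walk p vs xs"
  shows "length vs = length xs + 1" "\<And>i. i < length xs \<Longrightarrow> xs ! i \<in> A (vs ! i) (vs ! Suc i)"
    "\<And>i. Suc i < length xs \<Longrightarrow> xs ! i \<noteq> xs ! Suc i"
proof -
  \<comment> \<open>The clause on \<open>p\<close> is what makes consecutive colours differ in the
    induction; under the bounded quantifier it is vacuous for a walk without edges.\<close>
  have "length vs = length xs + 1 \<and> (\<forall>i<length xs. xs ! i \<in> A (vs ! i) (vs ! Suc i) \<and> p \<noteq> Some (xs ! 0)) \<and>
    (\<forall>i. Suc i < length xs \<longrightarrow> xs ! i \<noteq> xs ! Suc i)"
    using assms
  proof (induction p vs xs rule: walk.induct)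
    case (2 p u v vs x xs)
    thus ?case by (auto simp: nth_Cons split: nat.splits)
  qed auto
  thus "length vs = length xs + 1" "\<And>i. i < length xs \<Longrightarrow> xs ! i \<in> A (vs ! i) (vs ! Suc i)"
    "\<And>i. Suc i < length xs \<Longrightarrow> xs ! i \<noteq> xs ! Suc i" by auto
qed

end

section \<open>Averaging over the colours\<close>

text \<open>Discarding an element of value at most \<open>t\<close> keeps the average above
  \<open>t\<close>. If there is none, any three elements do.\<close>

lemma exists_three_heavy:
  fixes f :: "'a \<Rightarrow> nat"
  assumes "finite C" "card C \<ge> 3" "sum f C > card C * t"
  shows "\<exists>D\<subseteq>C. card D = 3 \<and> sum f D > 3 * t"
  using assms
proof (induction "card C" arbitrary: C rule: less_induct)
  case less
  show ?case
  proof (cases "card C = 3")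
    case True thus ?thesis using less.prems by auto
  next
    case False
    show ?thesis
    proof (cases "\<exists>i\<in>C. f i \<le> t")
      case True
      then obtain i where i: "i \<in> C" "f i \<le> t" by blast
      have c: "card C = card (C - {i}) + 1" using i less.prems(1) less.prems(2) by simp
      have "sum f C = f i + sum f (C - {i})" using i less.prems(1) by (simp add: sum.remove)
      hence "sum f (C - {i}) > card (C - {i}) * t" using less.prems(3) i(2) unfolding c by simp
      hence "\<exists>D\<subseteq>C - {i}. card D = 3 \<and> sum f D > 3 * t"
        using less.hyps[of "C - {i}"] c False less.prems by auto
      thus ?thesis by blast
    next
      case all: False
      obtain D where D: "D \<subseteq> C" "card D = 3"
        using less.prems(2) by (meson obtain_subset_with_card_n)
      have "t + 1 \<le> f i" if "i \<in> D" for i using that all D(1) by (auto simp: not_le Suc_le_eq)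
      from sum_bounded_below[of D "t + 1" f, OF this] have "card D * (t + 1) \<le> sum f D" by simp
      thus ?thesis using D by auto
    qed
  qed
qed

section \<open>Transfer to edge-coloured multigraphs\<close>

context edge_coloured_multigraph
begin

definition colours_between :: "nat set \<Rightarrow> 'v \<Rightarrow> 'v \<Rightarrow> nat set" where
  "colours_between D u v = {x \<in> D. \<exists>e\<in>E. ends e = {u, v} \<and> col e = x}"

lemma three_coloured_colours_between: "card D = 3 \<Longrightarrow> three_coloured D (colours_between D)"
  by unfold_locales (auto simp: colours_between_def insert_commute)

text \<open>Each edge is counted for both orders of its ends, and \<open>col\<close> is injective on
  parallel edges.\<close>

lemma sum_card_colours_between:
  assumes "finite E"
  shows "2 * card {e \<in> E. col e \<in> D} \<le> (\<Sum>v\<in>V. \<Sum>u\<in>V - {v}. card (colours_between D v u))"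
proof -
  let ?F = "{e \<in> E. col e \<in> D}"
  have "2 * card ?F = (\<Sum>e\<in>?F. \<Sum>v\<in>V. \<Sum>u\<in>V - {v}. if ends e = {v, u} then 1 else 0)" (is "_ = ?S")
  proof -
    have "(\<Sum>v\<in>V. \<Sum>u\<in>V - {v}. if ends e = {v, u} then 1 else 0) = (2::nat)" if "e \<in> ?F" for e
    proof -
      have e: "ends e \<subseteq> V" "card (ends e) = 2" using ends_vertices that by auto
      then obtain a b where ab: "ends e = {a, b}" "a \<noteq> b" by (meson card_2_iff)
      have "(\<Sum>u\<in>V - {v}. if ends e = {v, u} then 1 else 0) = (if v \<in> {a, b} then 1 else (0::nat))" for v
      proof -
        have "(\<Sum>u\<in>V - {v}. if ends e = {v, u} then 1 else 0) = card {u \<in> V - {v}. ends e = {v, u}}"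
          using finite_vertices by (simp add: sum.If_cases Int_def)
        moreover have "{u \<in> V - {v}. ends e = {v, u}} =
            (if v = a then {b} else if v = b then {a} else {})"
          using ab e by (auto simp: doubleton_eq_iff)
        ultimately show ?thesis by auto
      qed
      hence "(\<Sum>v\<in>V. \<Sum>u\<in>V - {v}. if ends e = {v, u} then 1 else 0) =
          (\<Sum>v\<in>V. if v \<in> {a, b} then 1 else (0::nat))" by simp
      also have "\<dots> = card (V \<inter> {a, b})"
        using finite_vertices by (simp only: sum.If_cases) (simp add: Int_def)
      also have "V \<inter> {a, b} = ends e" using ab e by auto
      finally show ?thesis using e by simp
    qed
    thus ?thesis by simp
  qed
  also have "?S = (\<Sum>v\<in>V. \<Sum>u\<in>V - {v}. \<Sum>e\<in>?F. if ends e = {v, u} then 1 else 0)"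
    by (subst sum.swap, rule sum.cong, rule refl, subst sum.swap, rule refl)
  also have "\<dots> = (\<Sum>v\<in>V. \<Sum>u\<in>V - {v}. card {e \<in> ?F. ends e = {v, u}})"
    using assms by (intro sum.cong refl) (simp add: sum.If_cases Int_def)
  also have "\<dots> \<le> (\<Sum>v\<in>V. \<Sum>u\<in>V - {v}. card (colours_between D v u))"
  proof (intro sum_mono)
    fix v u
    have "inj_on col {e \<in> ?F. ends e = {v, u}}"
      using parallel_colours by (intro inj_onI) fastforce
    moreover have "col ` {e \<in> ?F. ends e = {v, u}} = colours_between D v u"
      by (auto simp: colours_between_def)
    ultimately show "card {e \<in> ?F. ends e = {v, u}} \<le> card (colours_between D v u)"
      using card_image[of col "{e \<in> ?F. ends e = {v, u}}"] by simp
  qed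
  finally show ?thesis .
qed

text \<open>Membership in \<open>colours_between\<close> supplies an edge of the right colour for
  each step of the walk.\<close>

lemma proper_hamiltonian_path_if_traceable:
  assumes "card D = 3" "three_coloured.traceable (colours_between D) V"
  shows "\<exists>vs es. is_proper_hamiltonian_path vs es"
proof -
  interpret three_coloured D "colours_between D"
    by (rule three_coloured_colours_between[OF assms(1)])
  obtain vs xs where w: "walk None vs xs" "distinct vs" "set vs = V"
    using assms(2) unfolding traceable_def by blast
  have "\<exists>e. e \<in> E \<and> ends e = {vs ! i, vs ! Suc i} \<and> col e = xs ! i" if "i < length xs" for i
    using walk_nth(2)[OF w(1) that] by (auto simp: colours_between_def)
  then obtain g where g: "\<And>i. i < length xs \<Longrightarrow> g i \<in> E \<and> ends (g i) = {vs ! i, vs ! Suc i} \<and> col (g i) = xs ! i"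
    by metis
  have "is_proper_hamiltonian_path vs (map g [0..<length xs])"
    unfolding is_proper_hamiltonian_path_def is_proper_path_def is_path_def
    using w walk_nth[OF w(1)] g by auto
  thus ?thesis by blast
qed

lemma exists_proper_hamiltonian_path:
  assumes "card V \<ge> 2" "c \<ge> 3" "card E > c * ((card V - 1) choose 2)"
  shows "\<exists>vs es. is_proper_hamiltonian_path vs es"
proof -
  define n where "n = card V"
  have fE: "finite E" using assms(3) by (metis card.infinite not_less_zero)
  have "card E = (\<Sum>i\<in>{1..c}. card {e \<in> E. col e = i})"
    using colour_range fE by (subst card_eq_sum, subst sum.group[symmetric, of _ "{1..c}" col]) auto
  then obtain D where D: "D \<subseteq> {1..c}" "card D = 3"
    and heavy: "(\<Sum>i\<in>D. card {e \<in> E. col e = i}) > 3 * ((n - 1) choose 2)"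
    using exists_three_heavy[of "{1..c}" "(n - 1) choose 2" "\<lambda>i. card {e \<in> E. col e = i}"] assms
    by (auto simp: n_def)
  have finD: "finite D" using D finite_subset by blast
  interpret three_coloured D "colours_between D"
    by (rule three_coloured_colours_between[OF D(2)])
  have "card {e \<in> E. col e \<in> D} = (\<Sum>i\<in>D. card {e \<in> {e \<in> E. col e \<in> D}. col e = i})"
    using fE finD by (subst card_eq_sum, subst sum.group[symmetric, of _ D col]) auto
  also have "\<dots> = (\<Sum>i\<in>D. card {e \<in> E. col e = i})"
    by (intro sum.cong refl arg_cong[where f = card]) auto
  finally have edges: "card {e \<in> E. col e \<in> D} > 3 * ((n - 1) choose 2)" using heavy by simp
  have "sum (deficit V) V + (\<Sum>v\<in>V. \<Sum>u\<in>V - {v}. card (colours_between D v u)) =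
      (\<Sum>v\<in>V. \<Sum>u\<in>V - {v}. miss v u + card (colours_between D v u))"
    by (simp add: deficit_def sum.distrib)
  also have "\<dots> = 3 * n * (n - 1)"
    using finite_vertices by (simp add: miss_card_A n_def)
  \<comment> \<open>Since \<open>3 * n * (n - 1)\<close> exceeds
    \<open>3 * (n - 1) * (n - 2)\<close> by \<open>6 * (n - 1)\<close>, the lower bound on the edges
    gives the required total.\<close>
  finally have T: "sum (deficit V) V + 2 * card {e \<in> E. col e \<in> D} \<le> 3 * n * (n - 1)"
    using sum_card_colours_between[OF fE, of D] by linarith
  obtain k where k: "n = k + 2" using assms(1) unfolding n_def by (metis add.commute le_iff_add)
  have "2 * ((n - 1) choose 2) = (k + 1) * k"
    using k by (simp add: choose_two)
  hence "sum (deficit V) V < 6 * (card V - 1)"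
    using T edges k unfolding n_def[symmetric] by (simp add: algebra_simps)
  hence "traceable V" by (intro traceable_if_total_deficit finite_vertices)
  thus ?thesis using proper_hamiltonian_path_if_traceable D(2) by blast
qed

end

theorem theorem4p4:
  fixes V :: "'v set" and E :: "'e set"
    and ends :: "'e \<Rightarrow> 'v set" and col :: "'e \<Rightarrow> nat"
    and c n m :: nat
  assumes "edge_coloured_multigraph V E ends col c"
    and "card V = n" and "n \<ge> 2"
    and "c \<ge> 3"
    and "card E = m"
    and "m \<ge> c * ((n - 1) choose 2) + 1"
  shows "\<exists>vs es. edge_coloured_multigraph.is_proper_hamiltonian_path V E ends col vs es"
  using edge_coloured_multigraph.exists_proper_hamiltonian_path[OF assms(1)] assms(2-) by simp

end
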